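(* Assume that $\kappa$ is compatible with $(d,\eta,p)$ and let $\alpha\in Q^+$ be such that $\mathcal{P}_\alpha^\kappa$ is not empty. Then $\#[\alpha]$ is the smallest element of the set $\{\#[\lambda] : \lambda\in\mathcal{P}_\alpha^\kappa\}$. In other words, if $\lambda$ is an $r$-partition and $\alpha := \alpha_\kappa(\lambda)$, and if $\sigma^j\cdot\alpha=\alpha$ for some $j\in\{0,\dots,p-1\}$, then there exists an $r$-partition $\mu$ such that $\alpha_\kappa(\mu)=\alpha$ and ${}^{\sigma^j}\mu=\mu$.
   Context: Let $d,\eta,p\geq 1$ be integers, put $e := \eta p$ (assumed $\geq 2$) and $r := dp$. Identify $\mathbb{Z}/e\mathbb{Z}$ with $\{0,\dots,e-1\}$ and $\mathbb{Z}/r\mathbb{Z}$ with $\{0,\dots,r-1\}$. A multicharge $\kappa=(\kappa_0,\dots,\kappa_{r-1})\in(\mathbb{Z}/e\mathbb{Z})^r$ is compatible with $(d,\eta,p)$ if $\kappa_{k+d}=\kappa_k+\eta$ for all $k\in\mathbb{Z}/r\mathbb{Z}$. A partition is a finite non-increasing sequence of positive integers $\lambda=(\lambda_0,\dots,\lambda_{h-1})$; its Young diagram is $\mathcal{Y}(\lambda)=\{(a,b)\in\mathbb{N}^2 : 0\le a\le h-1,\ 0\le b\le\lambda_a-1\}$. An $r$-partition is an $r$-tuple $\lambda=(\lambda^{(0)},\dots,\lambda^{(r-1)})$ of partitions; its Young diagram is $\mathcal{Y}(\lambda)=\bigcup_{c=0}^{r-1}\mathcal{Y}(\lambda^{(c)})\times\{c\}$.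 The $\kappa$-residue of a node $(a,b,c)$ is $\mathrm{res}_\kappa(a,b,c)=b-a+\kappa_c\in\mathbb{Z}/e\mathbb{Z}$. Let $Q=\bigoplus_{i\in\mathbb{Z}/e\mathbb{Z}}\mathbb{Z}\alpha_i$ be a free $\mathbb{Z}$-module with basis $(\alpha_i)_{i\in\mathbb{Z}/e\mathbb{Z}}$ and $Q^+=\bigoplus_i\mathbb{N}\alpha_i$. For an $r$-partition $\lambda$ put $\alpha_\kappa(\lambda)=\sum_{\gamma\in\mathcal{Y}(\lambda)}\alpha_{\mathrm{res}_\kappa(\gamma)}\in Q^+$. For $\alpha\in Q^+$, $\mathcal{P}_\alpha^\kappa$ is the set of $r$-partitions $\lambda$ with $\alpha_\kappa(\lambda)=\alpha$. Shifts: on $Q$, $\sigma$ is the $\mathbb{Z}$-linear map with $\sigma\cdot\alpha_i=\alpha_{i+\eta}$; on $r$-partitions, ${}^{\sigma}\lambda=(\lambda^{(r-d)},\dots,\lambda^{(r-1)},\lambda^{(0)},\dots,\lambda^{(r-d-1)})$, and ${}^{\sigma^j}\lambda$ is the result of applying this map $j$ times. The symbols $[\lambda]$ and $[\alpha]$ denote the orbits of $\lambda$ and $\alpha$ under the corresponding action of $\sigma$. *)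

theory Defs
  imports "HOL-Library.Poly_Mapping" "HOL-Combinatorics.Orbits"
begin

text \<open>
  Conventions. Residue classes modulo \<open>e\<close> are the integers in \<open>{0..<int e}\<close>, indices modulo \<open>r\<close>
  are the naturals below \<open>r\<close>, and \<open>r\<close>-tuples are lists of length \<open>r\<close>.
\<close>

subsection \<open>Multicharges\<close>

definition multicharge :: "nat \<Rightarrow> nat \<Rightarrow> int list \<Rightarrow> bool" where
  "multicharge e r \<kappa> \<longleftrightarrow> length \<kappa> = r \<and> set \<kappa> \<subseteq> {0..<int e}"

definition compatible :: "nat \<Rightarrow> nat \<Rightarrow> nat \<Rightarrow> int list \<Rightarrow> bool" where
  "compatible d \<eta> p \<kappa> \<longleftrightarrow>
     (\<forall>k<d * p. \<kappa> ! ((k + d) mod (d * p)) = (\<kappa> ! k + int \<eta>) mod int (\<eta> * p))"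

subsection \<open>Partitions and \<open>r\<close>-partitions\<close>

definition is_partition :: "nat list \<Rightarrow> bool" where
  "is_partition ps \<longleftrightarrow> sorted_wrt (\<ge>) ps \<and> (\<forall>x\<in>set ps. 0 < x)"

definition is_rpartition :: "nat \<Rightarrow> nat list list \<Rightarrow> bool" where
  "is_rpartition r L \<longleftrightarrow> length L = r \<and> (\<forall>ps\<in>set L. is_partition ps)"

definition young :: "nat list \<Rightarrow> (nat \<times> nat) set" where
  "young ps = {(a, b). a < length ps \<and> b < ps ! a}"

definition young_multi :: "nat list list \<Rightarrow> (nat \<times> nat \<times> nat) set" where
  "young_multi L = {(a, b, c). c < length L \<and> (a, b) \<in> young (L ! c)}"

lemma finite_young: "finite (young ps)"
proof -
  have "young ps = Sigma {..<length ps} (\<lambda>a. {..<ps ! a})"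
    by (auto simp: young_def)
  then show ?thesis by simp
qed

text \<open>The sum in the definition of \<open>alpha_of\<close> below is over a finite set.\<close>

lemma finite_young_multi: "finite (young_multi L)"
proof -
  have "young_multi L = (\<lambda>(c, a, b). (a, b, c)) ` Sigma {..<length L} (\<lambda>c. young (L ! c))"
    by (force simp: young_multi_def image_iff)
  then show ?thesis by (simp add: finite_young)
qed

definition residue :: "nat \<Rightarrow> int list \<Rightarrow> nat \<times> nat \<times> nat \<Rightarrow> int" where
  "residue e \<kappa> = (\<lambda>(a, b, c). (int b - int a + \<kappa> ! c) mod int e)"

subsection \<open>The root lattice\<close>

text \<open>
  \<open>Q\<close> is the free abelian group on \<open>{0..<int e}\<close>, realised inside \<open>int \<Rightarrow>\<^sub>0 int\<close> as the elements
  supported there; the basis vector \<open>\<alpha>\<^sub>i\<close> is \<open>frag_of i\<close>.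
\<close>

definition Q_plus :: "nat \<Rightarrow> (int \<Rightarrow>\<^sub>0 int) set" where
  "Q_plus e = {x. Poly_Mapping.keys x \<subseteq> {0..<int e} \<and> (\<forall>i. 0 \<le> Poly_Mapping.lookup x i)}"

definition alpha_of :: "nat \<Rightarrow> int list \<Rightarrow> nat list list \<Rightarrow> (int \<Rightarrow>\<^sub>0 int)" where
  "alpha_of e \<kappa> L = (\<Sum>\<gamma>\<in>young_multi L. frag_of (residue e \<kappa> \<gamma>))"

definition rpartitions_of :: "nat \<Rightarrow> nat \<Rightarrow> int list \<Rightarrow> (int \<Rightarrow>\<^sub>0 int) \<Rightarrow> nat list list set" where
  "rpartitions_of e r \<kappa> \<alpha> = {L. is_rpartition r L \<and> alpha_of e \<kappa> L = \<alpha>}"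

subsection \<open>The shifts and their orbits\<close>

definition shift_Q :: "nat \<Rightarrow> nat \<Rightarrow> (int \<Rightarrow>\<^sub>0 int) \<Rightarrow> (int \<Rightarrow>\<^sub>0 int)" where
  "shift_Q \<eta> e = frag_extend (\<lambda>i. frag_of ((i + int \<eta>) mod int e))"

definition shift_rpart :: "nat \<Rightarrow> nat list list \<Rightarrow> nat list list" where
  "shift_rpart d L = drop (length L - d) L @ take (length L - d) L"

text \<open>
  Orbits under \<open>\<sigma>\<close> are expressed by \<^const>\<open>orbit\<close>, which only uses the iterates \<open>\<sigma>\<^sup>n\<close> with \<open>n > 0\<close>.
  Both shifts have order dividing \<open>p\<close>, so this is the full orbit of the group generated by \<open>\<sigma>\<close>,
  and it is finite.
\<close>

lemma orbit_of_period:
  assumes "0 < p" and "(f ^^ p) x = x"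
  shows "orbit f x = (\<lambda>j. (f ^^ j) x) ` {..<p}"
proof
  show "orbit f x \<subseteq> (\<lambda>j. (f ^^ j) x) ` {..<p}"
  proof
    fix y assume "y \<in> orbit f x"
    then obtain n where "y = (f ^^ n) x" by (auto simp: orbit_altdef)
    then have "y = (f ^^ (n mod p)) x" using funpow_mod_eq[OF assms(2), of n] by simp
    then show "y \<in> (\<lambda>j. (f ^^ j) x) ` {..<p}" using assms(1) by auto
  qed
next
  show "(\<lambda>j. (f ^^ j) x) ` {..<p} \<subseteq> orbit f x"
  proof
    fix y assume "y \<in> (\<lambda>j. (f ^^ j) x) ` {..<p}"
    then obtain j where "y = (f ^^ j) x" by auto
    then have "y = (f ^^ (j + p)) x" using assms(2) by (simp add: funpow_add)
    then show "y \<in> orbit f x" using assms(1) unfolding orbit_altdef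
      by (intro CollectI exI[of _ "j + p"]) simp
  qed
qed

lemma shift_Q_funpow:
  assumes "Poly_Mapping.keys x \<subseteq> {0..<int e}"
  shows "(shift_Q \<eta> e ^^ n) x = frag_extend (\<lambda>i. frag_of ((i + int n * int \<eta>) mod int e)) x"
proof (induction n)
  case 0
  have "frag_extend (\<lambda>i. frag_of (i mod int e)) x = frag_extend frag_of x"
    using assms by (intro frag_extend_eq) auto
  then show ?case by (simp flip: frag_expansion)
next
  case (Suc n)
  have "(shift_Q \<eta> e ^^ Suc n) x
      = frag_extend (\<lambda>i. frag_of ((i + int \<eta>) mod int e))
          (frag_extend (frag_of o (\<lambda>i. (i + int n * int \<eta>) mod int e)) x)"
    using Suc.IH by (simp add: shift_Q_def o_def)
  also have "\<dots> = frag_extend (\<lambda>i. frag_of (((i + int n * int \<eta>) mod int e + int \<eta>) mod int e)) x"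
    by (subst frag_extend_compose) (simp add: o_def)
  also have "\<dots> = frag_extend (\<lambda>i. frag_of ((i + int (Suc n) * int \<eta>) mod int e)) x"
    by (simp add: mod_simps algebra_simps)
  finally show ?case .
qed

lemma shift_Q_period:
  assumes "Poly_Mapping.keys x \<subseteq> {0..<int (\<eta> * p)}"
  shows "(shift_Q \<eta> (\<eta> * p) ^^ p) x = x"
proof -
  have "(shift_Q \<eta> (\<eta> * p) ^^ p) x = frag_extend frag_of x"
    unfolding shift_Q_funpow[OF assms]
  proof (rule frag_extend_eq)
    fix i assume "i \<in> Poly_Mapping.keys x"
    then have "0 \<le> i" "i < int (\<eta> * p)" using assms by auto
    moreover have "i + int p * int \<eta> = i + int (\<eta> * p)" by (simp add: mult.commute)
    ultimately show "frag_of ((i + int p * int \<eta>) mod int (\<eta> * p)) = frag_of i"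
      by (simp only: mod_add_self2 mod_pos_pos_trivial)
  qed
  then show ?thesis by (simp flip: frag_expansion)
qed

lemma shift_rpart_eq_rotate:
  assumes "0 < d" and "d \<le> length L"
  shows "shift_rpart d L = rotate (length L - d) L"
  using assms by (simp add: shift_rpart_def rotate_drop_take)

lemma shift_rpart_period:
  assumes "0 < d" and "0 < p" and "length L = d * p"
  shows "(shift_rpart d ^^ p) L = L"
proof -
  have "(shift_rpart d ^^ n) L = rotate (n * (d * p - d)) L" for n
  proof (induction n)
    case (Suc n)
    then show ?case
      using assms by (simp add: shift_rpart_eq_rotate rotate_rotate)
  qed simp
  moreover have "p * (d * p - d) = length L * (p - 1)"
    using assms by (simp add: algebra_simps diff_mult_distrib2)
  ultimately show ?thesis by (simp add: rotate_id)
qed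

end

theory Submission
  imports Defs "HOL-Number_Theory.Cong"
begin

text \<open>
  Both assertions rest on one existence statement: a nonempty block \<open>\<alpha>\<close> fixed by \<open>\<sigma>\<^sup>j\<close> contains an
  \<open>r\<close>-partition fixed by \<open>\<sigma>\<^sup>j\<close> (\<open>fixed_rpartition_of_fixed_block\<close>). The map from \<open>r\<close>-partitions to
  blocks commutes with the shifts, so the orbit of an \<open>r\<close>-partition maps onto the orbit of its block
  and is at least as large. With \<open>m = #[\<alpha>]\<close>, the block is fixed by \<open>\<sigma>\<^sup>m\<close>, and an \<open>r\<close>-partition in the
  block fixed by \<open>\<sigma>\<^sup>m\<close> has an orbit of size exactly \<open>m\<close>.

  For the existence statement, put \<open>g = gcd j p\<close>. If \<open>\<alpha>\<close> is fixed by \<open>\<sigma>\<^sup>j\<close>, then the number of nodes of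
  residue \<open>i\<close> depends only on \<open>i\<close> modulo \<open>\<eta> g\<close>; and an \<open>r\<close>-partition is fixed by \<open>\<sigma>\<^sup>j\<close> if its
  components depend only on their index modulo \<open>d g\<close>. Compatibility of the charges shows that such a
  periodic \<open>r\<close>-partition is counted by the same function as its first \<open>d g\<close> components with residues
  taken modulo \<open>\<eta> g\<close> (\<open>unfold_diagram\<close>). It therefore suffices to show that a periodic function counting
  the residues of some \<open>r\<close>-partition in the large system (\<open>d p\<close> charges modulo \<open>\<eta> p\<close>) also does so for
  some multipartition in the small system (\<open>d g\<close> charges modulo \<open>\<eta> g\<close>).

  This is a question about weights of Fock spaces of affine \<open>sl\<^sub>e\<close>, and it is answered by the action of
  the affine Weyl group. The number of addable minus the number of removable nodes of residue \<open>i\<close>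
  depends only on the block: it is the hub, the value of the weight at the \<open>i\<close>-th simple coroot
  (\<open>addable_minus_removable\<close>). Adding or deleting that many nodes realizes the simple reflection
  (\<open>realizable_raise\<close>, \<open>realizable_lower\<close>). Moreover, every dominant weight below the highest one occurs,
  by a maximum principle for second differences on a circle (\<open>realizable_of_dominant\<close>). For periodic
  functions the hubs of the two systems agree, and a reflection of the small system is a product of
  commuting reflections of the large one. So a periodic function can be made dominant by reflections in
  the large system, which preserve realizability there; the dominant function is realizable in the small
  system because dominance and nonnegativity suffice; and the reflections can be undone in the small
  system (\<open>realizable_fold\<close>).
\<close>

section \<open>Diagrams, residue counts and hubs\<close>

type_synonym node = "nat \<times> nat \<times> nat"

fun content :: "(nat \<Rightarrow> int) \<Rightarrow> node \<Rightarrow> int" where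
  "content \<kappa> (a, b, c) = int b - int a + \<kappa> c"

text \<open>
  A diagram is the Young diagram of an \<open>r\<close>-partition, seen as a set: its components are the slices with
  fixed last coordinate. For sets, adding or deleting several nodes at once needs no bookkeeping of
  row lengths.
\<close>

definition diagram :: "nat \<Rightarrow> node set \<Rightarrow> bool" where
  "diagram r Y \<longleftrightarrow> finite Y \<and>
     (\<forall>a b c. (a, b, c) \<in> Y \<longrightarrow> c < r \<and> (\<forall>a'\<le>a. \<forall>b'\<le>b. (a', b', c) \<in> Y))"

text \<open>
  Residues are handled as integers up to congruence, so that \<open>i - 1\<close> and \<open>i + 1\<close> are always defined and
  a single formula covers every modulus, including \<open>1\<close> and \<open>2\<close>. All functions of the residue are
  therefore periodic.
\<close>

definition node_count :: "nat \<Rightarrow> (nat \<Rightarrow> int) \<Rightarrow> node set \<Rightarrow> int \<Rightarrow> int" where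
  "node_count e \<kappa> Y i = int (card {\<gamma>\<in>Y. [content \<kappa> \<gamma> = i] (mod int e)})"

definition realizable :: "nat \<Rightarrow> nat \<Rightarrow> (nat \<Rightarrow> int) \<Rightarrow> (int \<Rightarrow> int) \<Rightarrow> bool" where
  "realizable e r \<kappa> f \<longleftrightarrow> (\<exists>Y. diagram r Y \<and> node_count e \<kappa> Y = f)"

definition charge_count :: "nat \<Rightarrow> nat \<Rightarrow> (nat \<Rightarrow> int) \<Rightarrow> int \<Rightarrow> int" where
  "charge_count e r \<kappa> i = int (card {c. c < r \<and> [\<kappa> c = i] (mod int e)})"

text \<open>
  If \<open>f\<close> counts the nodes by residue, this is the value of \<open>\<Lambda> - \<alpha>\<close> at the \<open>i\<close>-th simple coroot of
  affine \<open>sl\<^sub>e\<close>, where \<open>\<alpha> = \<Sum>\<^sub>i f(i) \<alpha>\<^sub>i\<close> and \<open>\<Lambda>\<close> is the sum of the fundamental weights of the charges.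
\<close>

definition hub :: "nat \<Rightarrow> nat \<Rightarrow> (nat \<Rightarrow> int) \<Rightarrow> (int \<Rightarrow> int) \<Rightarrow> int \<Rightarrow> int" where
  "hub e r \<kappa> f i = charge_count e r \<kappa> i + f (i - 1) + f (i + 1) - 2 * f i"

definition addable :: "nat \<Rightarrow> node set \<Rightarrow> node set" where
  "addable r Y = {(a, b, c). c < r \<and> (a, b, c) \<notin> Y \<and>
     (a = 0 \<or> (a - 1, b, c) \<in> Y) \<and> (b = 0 \<or> (a, b - 1, c) \<in> Y)}"

definition removable :: "node set \<Rightarrow> node set" where
  "removable Y = {(a, b, c). (a, b, c) \<in> Y \<and> (Suc a, b, c) \<notin> Y \<and> (a, Suc b, c) \<notin> Y}"

lemma diagram_finite: "diagram r Y \<Longrightarrow> finite Y"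
  and diagram_component: "diagram r Y \<Longrightarrow> (a, b, c) \<in> Y \<Longrightarrow> c < r"
  and diagram_down: "diagram r Y \<Longrightarrow> (a, b, c) \<in> Y \<Longrightarrow> a' \<le> a \<Longrightarrow> b' \<le> b \<Longrightarrow> (a', b', c) \<in> Y"
  unfolding diagram_def by blast+

lemma card_filter_eq_sum:
  "finite Y \<Longrightarrow> int (card {\<gamma>\<in>Y. P \<gamma>}) = (\<Sum>\<gamma>\<in>Y. of_bool (P \<gamma>))"
  by (simp add: Collect_conj_eq Int_commute)

lemma sum_of_bool_mem:
  fixes g :: "'a \<Rightarrow> int"
  assumes "finite U" "S \<subseteq> U"
  shows "(\<Sum>z\<in>U. of_bool (z \<in> S) * g z) = sum g S"
proof -
  have "(\<Sum>z\<in>U. of_bool (z \<in> S) * g z) = (\<Sum>z\<in>U. if z \<in> S then g z else 0)"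
    by (intro sum.cong) auto
  also have "\<dots> = sum g (U \<inter> S)" using assms by (simp add: sum.inter_restrict)
  also have "U \<inter> S = S" using assms by blast
  finally show ?thesis .
qed

text \<open>
  Both sides are sums over all nodes of a local contribution. In one component let \<open>y\<close> be the
  indicator function of the diagram, zero at negative coordinates. On a square with corners \<open>(a - 1, b - 1)\<close> and \<open>(a, b)\<close> the number
  \<open>y(a - 1, b) + y(a, b - 1) - y(a - 1, b - 1) - y(a, b)\<close> is \<open>1\<close> if \<open>(a, b)\<close> is addable, \<open>-1\<close> if
  \<open>(a - 1, b - 1)\<close> is removable, and \<open>0\<close> otherwise. The nodes \<open>(a, b)\<close> and \<open>(a - 1, b - 1)\<close> have the same
  content, and the other two have neighbouring contents, which produces the second difference of the
  hub; the origin of each component is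
  the exception, where the number is too small by one, and this produces the term counting charges.
\<close>

lemma addable_minus_removable:
  fixes e :: nat and \<kappa> :: "nat \<Rightarrow> int" and i :: int
  assumes Y: "diagram r Y"
  defines "R \<equiv> \<lambda>i \<gamma>. [content \<kappa> \<gamma> = i] (mod int e)"
  shows "finite (addable r Y)"
    and "int (card {\<gamma>\<in>addable r Y. R i \<gamma>}) - int (card {\<gamma>\<in>removable Y. R i \<gamma>})
      = hub e r \<kappa> (node_count e \<kappa> Y) i"
proof -
  have fY: "finite Y" using Y by (rule diagram_finite)
  define s1 where "s1 = (\<lambda>(a, b, c). (Suc a, b, c) :: node)"
  define s2 where "s2 = (\<lambda>(a, b, c). (a, Suc b, c) :: node)"
  define s3 where "s3 = (\<lambda>(a, b, c). (Suc a, Suc b, c) :: node)"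
  define corner where "corner = (\<lambda>c. (0, 0, c) :: node) ` {..<r}"
  have inj: "inj_on s1 X" "inj_on s2 X" "inj_on s3 X" for X
    unfolding s1_def s2_def s3_def by (auto simp: inj_on_def)
  have s1m: "(a, b, c) \<in> s1 ` X \<longleftrightarrow> a \<noteq> 0 \<and> (a - 1, b, c) \<in> X" for a b c X
    unfolding s1_def by (cases a) (force simp: image_iff)+
  have s2m: "(a, b, c) \<in> s2 ` X \<longleftrightarrow> b \<noteq> 0 \<and> (a, b - 1, c) \<in> X" for a b c X
    unfolding s2_def by (cases b) (force simp: image_iff)+
  have s3m: "(a, b, c) \<in> s3 ` X \<longleftrightarrow> a \<noteq> 0 \<and> b \<noteq> 0 \<and> (a - 1, b - 1, c) \<in> X" for a b c X
    unfolding s3_def by (cases a; cases b) (force simp: image_iff)+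
  have corner_m: "(a, b, c) \<in> corner \<longleftrightarrow> a = 0 \<and> b = 0 \<and> c < r" for a b c
    unfolding corner_def by auto
  define U where "U = addable r Y \<union> corner \<union> s1 ` Y \<union> s2 ` Y \<union> s3 ` Y \<union> Y"
  have "addable r Y \<subseteq> corner \<union> s1 ` Y \<union> s2 ` Y"
  proof
    fix z assume z: "z \<in> addable r Y"
    obtain a b c where abc: "z = (a, b, c)" by (cases z)
    show "z \<in> corner \<union> s1 ` Y \<union> s2 ` Y"
      using z unfolding abc Un_iff corner_m s1m s2m addable_def by auto
  qed
  moreover have "finite (corner \<union> s1 ` Y \<union> s2 ` Y)" using fY by (simp add: corner_def)
  ultimately show fA: "finite (addable r Y)" by (rule finite_subset)
  have sub: "removable Y \<subseteq> Y" by (auto simp: removable_def)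
  then have fR: "finite (removable Y)" using fY finite_subset by blast
  have fU: "finite U" using fY fA by (simp add: U_def corner_def)
  define g :: "node \<Rightarrow> int" where "g = (\<lambda>z. of_bool (R i z))"
  \<comment> \<open>The local identity at the square whose far corner is z: removable nodes and the diagram
      are shifted by s1, s2, s3 so that all the terms sit at z.\<close>
  have pt: "of_bool (z \<in> addable r Y) - of_bool (z \<in> s3 ` removable Y)
      = of_bool (z \<in> corner) + of_bool (z \<in> s1 ` Y) + of_bool (z \<in> s2 ` Y)
        - of_bool (z \<in> s3 ` Y) - (of_bool (z \<in> Y) :: int)" for z
  proof -
    obtain a b c where z: "z = (a, b, c)" by (cases z)
    have d1: "(a, b, c) \<in> Y \<Longrightarrow> c < r \<and> (a - 1, b, c) \<in> Y \<and> (a, b - 1, c) \<in> Y"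
      using diagram_component[OF Y] diagram_down[OF Y] by (meson diff_le_self order_refl)
    have d2: "(a - 1, b, c) \<in> Y \<Longrightarrow> c < r \<and> (a - 1, b - 1, c) \<in> Y"
      using diagram_component[OF Y] diagram_down[OF Y] by (meson diff_le_self order_refl)
    have d3: "(a, b - 1, c) \<in> Y \<Longrightarrow> c < r \<and> (a - 1, b - 1, c) \<in> Y"
      using diagram_component[OF Y] diagram_down[OF Y] by (meson diff_le_self order_refl)
    show ?thesis
      unfolding z s1m s2m s3m corner_m
      using d1 d2 d3
      by (cases a; cases b) (auto simp: addable_def removable_def)
  qed
  have subs: "addable r Y \<subseteq> U" "s3 ` removable Y \<subseteq> U" "corner \<subseteq> U" "s1 ` Y \<subseteq> U"
      "s2 ` Y \<subseteq> U" "s3 ` Y \<subseteq> U" "Y \<subseteq> U"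
    using sub by (auto simp: U_def)
  have "(\<Sum>z\<in>U. (of_bool (z \<in> addable r Y) - of_bool (z \<in> s3 ` removable Y)) * g z)
      = (\<Sum>z\<in>U. (of_bool (z \<in> corner) + of_bool (z \<in> s1 ` Y) + of_bool (z \<in> s2 ` Y)
        - of_bool (z \<in> s3 ` Y) - of_bool (z \<in> Y)) * g z)"
    by (simp only: pt)
  then have eq: "sum g (addable r Y) - sum g (s3 ` removable Y)
      = sum g corner + sum g (s1 ` Y) + sum g (s2 ` Y) - sum g (s3 ` Y) - sum g Y"
    by (simp only: left_diff_distrib distrib_right sum_subtractf sum.distrib
        sum_of_bool_mem[OF fU] subs)
  have g1: "g (s1 z) = of_bool (R (i + 1) z)" for z
    by (cases z) (simp add: g_def R_def s1_def cong_iff_dvd_diff algebra_simps)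
  have g2: "g (s2 z) = of_bool (R (i - 1) z)" for z
    by (cases z) (simp add: g_def R_def s2_def cong_iff_dvd_diff algebra_simps)
  have g3: "g (s3 z) = g z" for z
    by (cases z) (simp add: g_def R_def s3_def cong_iff_dvd_diff algebra_simps)
  have "sum g corner = charge_count e r \<kappa> i"
    unfolding corner_def charge_count_def
    by (subst sum.reindex) (auto simp: inj_on_def g_def R_def Collect_conj_eq lessThan_def)
  moreover have "sum g (s1 ` Y) = node_count e \<kappa> Y (i + 1)"
    unfolding node_count_def card_filter_eq_sum[OF fY] sum.reindex[OF inj(1)]
    by (simp add: g1 R_def)
  moreover have "sum g (s2 ` Y) = node_count e \<kappa> Y (i - 1)"
    unfolding node_count_def card_filter_eq_sum[OF fY] sum.reindex[OF inj(2)]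
    by (simp add: g2 R_def)
  moreover have "sum g Y = node_count e \<kappa> Y i"
    unfolding node_count_def card_filter_eq_sum[OF fY] by (simp add: g_def R_def)
  moreover have "sum g (s3 ` X) = sum g X" for X
    unfolding sum.reindex[OF inj(3)] by (simp add: g3)
  moreover have "sum g (addable r Y) = int (card {\<gamma>\<in>addable r Y. R i \<gamma>})"
    unfolding card_filter_eq_sum[OF fA] by (simp add: g_def)
  moreover have "sum g (removable Y) = int (card {\<gamma>\<in>removable Y. R i \<gamma>})"
    unfolding card_filter_eq_sum[OF fR] by (simp add: g_def)
  ultimately show "int (card {\<gamma>\<in>addable r Y. R i \<gamma>}) - int (card {\<gamma>\<in>removable Y. R i \<gamma>})
      = hub e r \<kappa> (node_count e \<kappa> Y) i"
    using eq by (simp add: hub_def)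
qed

text \<open>
  Nodes of different residues can be chosen independently.
\<close>

lemma choose_by_residue:
  assumes "finite A" and "0 < e"
    and per: "\<And>i j. [i = j] (mod int e) \<Longrightarrow> k i = k j"
    and le: "\<And>i. 0 \<le> k i \<and> k i \<le> node_count e \<kappa> A i"
  shows "\<exists>B\<subseteq>A. node_count e \<kappa> B = k"
proof -
  define N where "N i = {\<gamma>\<in>A. [content \<kappa> \<gamma> = i] (mod int e)}" for i
  have "\<exists>B. B \<subseteq> N i \<and> int (card B) = k i" for i
  proof -
    have "nat (k i) \<le> card (N i)"
      using le[of i] by (simp add: node_count_def N_def nat_le_iff)
    then obtain B where "B \<subseteq> N i" "card B = nat (k i)"
      by (rule obtain_subset_with_card_n)
    then show ?thesis using le[of i] by (intro exI[of _ B]) simp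
  qed
  then obtain B where B: "\<And>i. B i \<subseteq> N i" "\<And>i. int (card (B i)) = k i"
    by metis
  define C where "C = {\<gamma>\<in>A. \<gamma> \<in> B (content \<kappa> \<gamma> mod int e)}"
  have "node_count e \<kappa> C i = k i" for i
  proof -
    have "{\<gamma>\<in>C. [content \<kappa> \<gamma> = i] (mod int e)} = B (i mod int e)"
    proof (intro set_eqI iffI)
      fix \<gamma> assume "\<gamma> \<in> {\<gamma>\<in>C. [content \<kappa> \<gamma> = i] (mod int e)}"
      then show "\<gamma> \<in> B (i mod int e)" by (auto simp add: C_def cong_def)
    next
      fix \<gamma> assume g: "\<gamma> \<in> B (i mod int e)"
      then have "\<gamma> \<in> A" and "[content \<kappa> \<gamma> = i mod int e] (mod int e)" using B(1)[of "i mod int e"] by (auto simp: N_def)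
      then show "\<gamma> \<in> {\<gamma>\<in>C. [content \<kappa> \<gamma> = i] (mod int e)}"
        using g by (simp add: C_def cong_def)
    qed
    then have "node_count e \<kappa> C i = k (i mod int e)" by (simp add: node_count_def B(2))
    also have "\<dots> = k i" by (rule per) (simp add: cong_def)
    finally show ?thesis .
  qed
  then show ?thesis by (intro exI[of _ C]) (auto simp: C_def)
qed

lemma node_count_nonneg: "0 \<le> node_count e \<kappa> Y i"
  by (simp add: node_count_def)

lemma node_count_cong: "[i = j] (mod int e) \<Longrightarrow> node_count e \<kappa> Y i = node_count e \<kappa> Y j"
  by (simp add: node_count_def cong_def)

lemma realizable_nonneg: "realizable e r \<kappa> f \<Longrightarrow> 0 \<le> f i"
  by (auto simp: realizable_def node_count_nonneg)

lemma realizable_cong: "realizable e r \<kappa> f \<Longrightarrow> [i = j] (mod int e) \<Longrightarrow> f i = f j"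
  using node_count_cong by (auto simp: realizable_def)

lemma node_count_Un:
  "finite A \<Longrightarrow> finite B \<Longrightarrow> A \<inter> B = {} \<Longrightarrow>
   node_count e \<kappa> (A \<union> B) i = node_count e \<kappa> A i + node_count e \<kappa> B i"
  unfolding node_count_def
  by (subst of_nat_add[symmetric], subst card_Un_disjoint[symmetric])
     (auto intro!: arg_cong[of _ _ card])

text \<open>
  Any set of addable nodes can be added at once, since the nodes above and to the left of an addable
  node already belong to the diagram. There are at least \<open>hub i\<close> addable nodes of residue \<open>i\<close>. Taking
  \<open>k\<close> equal to the hub on one residue class is the simple reflection of affine \<open>sl\<^sub>e\<close>; the free choice
  of \<open>k\<close> gives products of commuting reflections in one step.
\<close>

lemma realizable_raise:
  assumes f: "realizable e r \<kappa> f" and "0 < e"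
    and per: "\<And>i j. [i = j] (mod int e) \<Longrightarrow> k i = k j"
    and le: "\<And>i. 0 \<le> k i \<and> k i \<le> max 0 (hub e r \<kappa> f i)"
  shows "realizable e r \<kappa> (\<lambda>i. f i + k i)"
proof -
  obtain Y where Y: "diagram r Y" and fY: "f = node_count e \<kappa> Y"
    using f by (auto simp: realizable_def)
  have "k i \<le> node_count e \<kappa> (addable r Y) i" for i
    using le[of i] addable_minus_removable(2)[OF Y, where \<kappa> = \<kappa> and e = e and i = i]
    unfolding fY node_count_def by linarith
  then have "\<exists>B\<subseteq>addable r Y. node_count e \<kappa> B = k"
    using le by (intro choose_by_residue[OF addable_minus_removable(1)[OF Y] \<open>0 < e\<close> per]) auto
  then obtain B where B: "B \<subseteq> addable r Y" and k: "node_count e \<kappa> B = k" by blast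
  have fin: "finite B" "finite Y"
    using finite_subset[OF B addable_minus_removable(1)[OF Y]] diagram_finite[OF Y] by auto
  have down: "c < r \<and> (a', b', c) \<in> Y \<union> B"
    if z: "(a, b, c) \<in> Y \<union> B" and le': "a' \<le> a" "b' \<le> b" for a b c a' b'
  proof (cases "(a, b, c) \<in> Y")
    case True
    then show ?thesis
      using diagram_component[OF Y] diagram_down[OF Y True le'] by auto
  next
    case False
    then have "(a, b, c) \<in> B" using z by simp
    moreover from this have "(a, b, c) \<in> addable r Y" using B by blast
    then have c: "c < r" and up: "a = 0 \<or> (a - 1, b, c) \<in> Y" and left: "b = 0 \<or> (a, b - 1, c) \<in> Y"
      by (auto simp: addable_def)
    moreover have "(a', b', c) \<in> Y" if "a' < a"
      using up diagram_down[OF Y, of "a - 1" b c a' b'] that le' by auto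
    moreover have "(a', b', c) \<in> Y" if "b' < b"
      using left diagram_down[OF Y, of a "b - 1" c a' b'] that le' by auto
    ultimately show ?thesis using le' by (metis Un_iff le_neq_implies_less)
  qed
  then have "diagram r (Y \<union> B)"
    using fin unfolding diagram_def by blast
  moreover have "Y \<inter> B = {}" using B by (auto simp: addable_def)
  then have "node_count e \<kappa> (Y \<union> B) = (\<lambda>i. f i + k i)"
    using fin by (auto simp: node_count_Un fY k)
  ultimately show ?thesis unfolding realizable_def by blast
qed

lemma realizable_lower:
  assumes f: "realizable e r \<kappa> f" and "0 < e"
    and per: "\<And>i j. [i = j] (mod int e) \<Longrightarrow> k i = k j"
    and le: "\<And>i. 0 \<le> k i \<and> k i \<le> max 0 (- hub e r \<kappa> f i)"
  shows "realizable e r \<kappa> (\<lambda>i. f i - k i)"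
proof -
  obtain Y where Y: "diagram r Y" and fY: "f = node_count e \<kappa> Y"
    using f by (auto simp: realizable_def)
  have sub: "removable Y \<subseteq> Y" by (auto simp: removable_def)
  then have fR: "finite (removable Y)" using diagram_finite[OF Y] finite_subset by blast
  have "k i \<le> node_count e \<kappa> (removable Y) i" for i
    using le[of i] addable_minus_removable(2)[OF Y, where \<kappa> = \<kappa> and e = e and i = i]
    unfolding fY node_count_def by linarith
  then have "\<exists>B\<subseteq>removable Y. node_count e \<kappa> B = k"
    using le by (intro choose_by_residue[OF fR \<open>0 < e\<close> per]) auto
  then obtain B where B: "B \<subseteq> removable Y" and k: "node_count e \<kappa> B = k" by blast
  have fin: "finite B" "finite Y"
    using finite_subset[OF B fR] diagram_finite[OF Y] by auto
  have down: "c < r \<and> (a', b', c) \<in> Y - B"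
    if z: "(a, b, c) \<in> Y - B" and le': "a' \<le> a" "b' \<le> b" for a b c a' b'
  proof -
    have abc: "(a, b, c) \<in> Y" using z by simp
    have "(a', b', c) \<notin> B" 
    proof
      assume "(a', b', c) \<in> B"
      then have rem: "(Suc a', b', c) \<notin> Y" "(a', Suc b', c) \<notin> Y" 
        using B by (auto simp: removable_def)
      have "a' = a" using rem(1) diagram_down[OF Y abc, of "Suc a'" b'] le' by linarith
      moreover have "b' = b" using rem(2) diagram_down[OF Y abc, of a' "Suc b'"] le' by linarith
      ultimately show False using \<open>(a', b', c) \<in> B\<close> z by simp
    qed
    then show ?thesis
      using diagram_component[OF Y abc] diagram_down[OF Y abc le'] by simp
  qed
  then have "diagram r (Y - B)"
    using fin unfolding diagram_def by blast
  moreover have "node_count e \<kappa> ((Y - B) \<union> B) i = node_count e \<kappa> (Y - B) i + node_count e \<kappa> B i" for i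
    using fin by (intro node_count_Un) auto
  then have "node_count e \<kappa> (Y - B) = (\<lambda>i. f i - k i)"
    using B sub by (auto simp: fY k Un_absorb2 fun_eq_iff)
  ultimately show ?thesis unfolding realizable_def by blast
qed

section \<open>Dominant residue counts\<close>

lemma hub_diff:
  "hub e r \<kappa> (\<lambda>i. f i - g i) i = hub e r \<kappa> f i - (g (i - 1) + g (i + 1) - 2 * g i)"
  by (simp add: hub_def)

lemma cong_representative:
  fixes i j :: int
  assumes "0 < e"
  obtains n where "n < e" and "[i + int n = j] (mod int e)"
proof
  show "nat ((j - i) mod int e) < e" using assms by (simp add: nat_less_iff)
  show "[i + int (nat ((j - i) mod int e)) = j] (mod int e)"
    using assms by (simp add: cong_def mod_simps)
qed

text \<open>
  A maximum principle. Let \<open>\<beta> = f - g\<close>, and suppose that the hub of \<open>g\<close> is nonpositive wherever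
  \<open>\<beta> > 0\<close>. Dominance of \<open>f\<close> says that at the maximum \<open>M > 0\<close> of \<open>\<beta>\<close> the second difference of \<open>\<beta>\<close> is at least
  minus the hub of \<open>g\<close>, hence nonnegative; so the neighbours are maxima too and the hub of \<open>g\<close> vanishes.
  The maximum propagates around the whole circle of residues. But the hubs add up to the number of
  charges, which is positive.
\<close>

lemma positive_hub_below_dominant:
  assumes "0 < e" "0 < r"
    and f: "\<And>i j. [i = j] (mod int e) \<Longrightarrow> f i = f j" "\<And>i. 0 \<le> hub e r \<kappa> f i"
    and g: "\<And>i j. [i = j] (mod int e) \<Longrightarrow> g i = g j" "\<And>i. g i \<le> f i"
    and neq: "g \<noteq> f"
  shows "\<exists>i. g i < f i \<and> 0 < hub e r \<kappa> g i"
proof (rule ccontr)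
  assume "\<not> ?thesis"
  then have le0: "hub e r \<kappa> g i \<le> 0" if "g i < f i" for i using that by force
  define \<beta> where "\<beta> i = f i - g i" for i
  have per: "\<beta> i = \<beta> j" if "[i = j] (mod int e)" for i j
    using f(1)[OF that] g(1)[OF that] by (simp add: \<beta>_def)
  define M where "M = Max (\<beta> ` {0..<int e})"
  have all: "\<beta> i \<in> \<beta> ` {0..<int e}" for i
    using per[of i "i mod int e"] \<open>0 < e\<close> by (intro image_eqI[of _ _ "i mod int e"]) auto
  have max: "\<beta> i \<le> M" for i
    unfolding M_def using all by (intro Max_ge) auto
  have "M \<in> \<beta> ` {0..<int e}"
    unfolding M_def using \<open>0 < e\<close> by (intro Max_in) auto
  then obtain i0 where i0: "\<beta> i0 = M" by auto
  obtain i1 where "g i1 \<noteq> f i1" using neq by auto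
  then have "0 < \<beta> i1" using g(2)[of i1] by (simp add: \<beta>_def)
  then have "0 < M" using max[of i1] by simp
  have hubs: "hub e r \<kappa> f i = hub e r \<kappa> g i + \<beta> (i - 1) + \<beta> (i + 1) - 2 * \<beta> i" for i
    by (simp add: hub_def \<beta>_def)
  have step: "\<beta> (i + 1) = M \<and> hub e r \<kappa> g i = 0" if "\<beta> i = M" for i
  proof -
    have "hub e r \<kappa> g i \<le> 0" using le0[of i] that \<open>0 < M\<close> by (simp add: \<beta>_def)
    then show ?thesis
      using f(2)[of i] hubs[of i] max[of "i + 1"] max[of "i - 1"] that by linarith
  qed
  have top: "\<beta> (i0 + int n) = M" for n
  proof (induction n)
    case (Suc n)
    then show ?case using step[of "i0 + int n"] by (simp add: algebra_simps)
  qed (simp add: i0)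
  then have zero: "hub e r \<kappa> g (i0 + int n) = 0" for n using step by blast
  define D where "D n = g (i0 + int n) - g (i0 + int n - 1)" for n
  have "(\<Sum>n<e. charge_count e r \<kappa> (i0 + int n)) = (\<Sum>n<e. - (D (Suc n) - D n))"
    using zero by (intro sum.cong) (auto simp: hub_def D_def algebra_simps)
  also have "\<dots> = D 0 - D e" by (simp add: sum_negf sum_lessThan_telescope')
  also have "\<dots> = 0"
    using g(1)[of "i0 + int e" i0] g(1)[of "i0 + int e - 1" "i0 - 1"]
    by (simp add: D_def cong_iff_dvd_diff)
  finally have "\<forall>n<e. charge_count e r \<kappa> (i0 + int n) = 0"
    by (subst (asm) sum_nonneg_eq_0_iff) (auto simp: charge_count_def)
  moreover obtain n where "n < e" "[i0 + int n = \<kappa> 0] (mod int e)"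
    using cong_representative[OF \<open>0 < e\<close>] by blast
  ultimately have "{c. c < r \<and> [\<kappa> c = i0 + int n] (mod int e)} = {}"
    by (simp add: charge_count_def)
  moreover have "0 \<in> {c. c < r \<and> [\<kappa> c = i0 + int n] (mod int e)}"
    using \<open>0 < r\<close> \<open>[i0 + int n = \<kappa> 0] (mod int e)\<close> by (simp add: cong_sym)
  ultimately show False by blast
qed

lemma sum_period_less:
  fixes g f :: "int \<Rightarrow> int"
  assumes "0 < e" and "\<And>i j. [i = j] (mod int e) \<Longrightarrow> f i = f j"
    and "\<And>i j. [i = j] (mod int e) \<Longrightarrow> g i = g j"
    and "\<And>i. g i \<le> f i" and "g i < f i"
  shows "sum g {0..<int e} < sum f {0..<int e}"
proof (rule sum_strict_mono_strong[of _ "i mod int e"])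
  have "g (i mod int e) = g i" "f (i mod int e) = f i" using assms(2,3) by simp_all
  then show "g (i mod int e) < f (i mod int e)" using assms(5) by simp
qed (use assms in auto)

text \<open>
  This is the combinatorial form of the fact that all dominant weights below \<open>\<Lambda>\<close> are weights of
  the representation of highest weight \<open>\<Lambda>\<close>. Start with the empty diagram and, as long as the target
  \<open>f\<close> is not reached, add a node of some residue that is both still missing and of positive hub.
\<close>

lemma realizable_of_dominant:
  assumes e: "0 < e" and r: "0 < r"
    and per: "\<And>i j. [i = j] (mod int e) \<Longrightarrow> f i = f j"
    and nonneg: "\<And>i. 0 \<le> f i" and dom: "\<And>i. 0 \<le> hub e r \<kappa> f i"
  shows "realizable e r \<kappa> f"
proof -
  have "realizable e r \<kappa> f" if "realizable e r \<kappa> g" "\<And>i. g i \<le> f i" for g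
    using that
  proof (induction "nat (sum f {0..<int e} - sum g {0..<int e})" arbitrary: g rule: less_induct)
    case less
    show ?case
    proof (cases "g = f")
      case False
      have gper: "\<And>i j. [i = j] (mod int e) \<Longrightarrow> g i = g j"
        using realizable_cong[OF less.prems(1)] .
      obtain i where i: "g i < f i" "0 < hub e r \<kappa> g i"
        using positive_hub_below_dominant[OF e r per dom gper less.prems(2) False] by blast
      define k where "k j = (of_bool [j = i] (mod int e) :: int)" for j
      have kper: "k j = k l" if "[j = l] (mod int e)" for j l
        using that by (auto simp: k_def cong_def)
      have at_i: "g j = g i \<and> f j = f i \<and> hub e r \<kappa> g j = hub e r \<kappa> g i" if "[j = i] (mod int e)" for j
      proof -
        have "[j + c = i + c] (mod int e)" for c using that by (rule cong_add) simp
        then show ?thesis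
          using gper[OF that] per[OF that] gper[of "j - 1" "i - 1"] gper[of "j + 1" "i + 1"] that
          by (simp add: hub_def charge_count_def cong_diff cong_add) (simp add: cong_def)
      qed
      have real: "realizable e r \<kappa> (\<lambda>j. g j + k j)"
      proof (rule realizable_raise[OF less.prems(1) e kper])
        show "0 \<le> k j \<and> k j \<le> max 0 (hub e r \<kappa> g j)" for j
          using at_i[of j] i by (auto simp: k_def)
      qed
      have le: "g j + k j \<le> f j" for j
        using at_i[of j] i less.prems(2)[of j] by (auto simp: k_def)
      have "sum g {0..<int e} < (\<Sum>j\<in>{0..<int e}. g j + k j)"
      proof (rule sum_period_less[OF e, where i = i])
        show "g j + k j = g l + k l" if "[j = l] (mod int e)" for j l
          using gper[OF that] kper[OF that] by simp
      qed (use gper in \<open>auto simp: k_def\<close>)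
      moreover have "(\<Sum>j\<in>{0..<int e}. g j + k j) \<le> sum f {0..<int e}"
        using le by (rule sum_mono)
      ultimately show ?thesis
        by (intro less.hyps[OF _ real le]) simp
    qed (use less.prems in simp)
  qed
  moreover have "realizable e r \<kappa> (\<lambda>_. 0)"
    unfolding realizable_def by (intro exI[of _ "{}"]) (auto simp: diagram_def node_count_def)
  ultimately show ?thesis using nonneg by blast
qed

section \<open>Unfolding residues and components\<close>

text \<open>
  Among the \<open>p\<close> lifts of a residue modulo \<open>h\<close> to residues modulo \<open>h p\<close>, each is reached by exactly
  one \<open>k\<close>.
\<close>

lemma card_unfold_residues:
  assumes "0 < h" and "0 < p"
  shows "card {(z, k). z \<in> Z \<and> k < p \<and> [v z + int (h * k) = i] (mod int (h * p))}
       = card {z \<in> Z. [v z = i] (mod int h)}" (is "card ?A = card ?B")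
proof (rule bij_betw_same_card)
  show "bij_betw fst ?A ?B"
    unfolding bij_betw_def
  proof
    have "k = l" if "k < p" "l < p" "[v z + int (h * k) = i] (mod int (h * p))"
        "[v z + int (h * l) = i] (mod int (h * p))" for z k l
    proof -
      have "[v z + int (h * k) = v z + int (h * l)] (mod int (h * p))"
        using that by (metis cong_sym cong_trans)
      then have "[int (h * k) = int (h * l)] (mod int (h * p))" by (simp add: cong_add_lcancel)
      then have "[h * k = h * l] (mod h * p)" by (simp only: cong_int_iff)
      then show "k = l" using that(1,2) \<open>0 < h\<close> by (simp add: cong_def mult_mod_right[symmetric])
    qed
    then show "inj_on fst ?A" by (auto simp: inj_on_def)
    show "fst ` ?A = ?B"
    proof (intro equalityI subsetI)
      fix z assume "z \<in> fst ` ?A"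
      then obtain k where z: "z \<in> Z" and k: "[v z + int (h * k) = i] (mod int (h * p))" by auto
      have "[v z + int (h * k) = i] (mod int h)"
        using k by (rule cong_dvd_modulus) simp
      then show "z \<in> ?B" using z by (simp add: cong_def)
    next
      fix z assume "z \<in> ?B"
      then have z: "z \<in> Z" and "int h dvd i - v z"
        by (auto simp: cong_iff_dvd_diff dvd_diff_commute)
      then obtain q where q: "i - v z = int h * q" by (auto elim: dvdE)
      define k where "k = nat (q mod int p)"
      have k: "int k = q - int p * (q div int p)"
        using \<open>0 < p\<close> by (simp add: k_def minus_mult_div_eq_mod)
      have "v z + int (h * k) - i = int (h * p) * - (q div int p)"
        using q by (simp add: k algebra_simps)

      then have "[v z + int (h * k) = i] (mod int (h * p))" by (simp add: cong_iff_dvd_diff)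
      moreover have "k < p" using \<open>0 < p\<close> by (simp add: k_def nat_less_iff)
      ultimately show "z \<in> fst ` ?A" using z by (force intro!: image_eqI[of _ _ "(z, k)"])
    qed
  qed
qed

definition unfold_diagram :: "nat \<Rightarrow> nat \<Rightarrow> node set \<Rightarrow> node set" where
  "unfold_diagram d p Z = {(a, b, c). c < d * p \<and> (a, b, c mod d) \<in> Z}"

text \<open>
  The charges are obtained from the first \<open>d\<close> of them as \<open>p\<close> blocks, each shifted by \<open>h\<close> from the
  previous one. This is how compatibility is used.
\<close>

definition unfolds :: "nat \<Rightarrow> nat \<Rightarrow> nat \<Rightarrow> (nat \<Rightarrow> int) \<Rightarrow> bool" where
  "unfolds d h p \<kappa> \<longleftrightarrow>
     (\<forall>c<d * p. [\<kappa> c = \<kappa> (c mod d) + int (h * (c div d))] (mod int (h * p)))"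

lemma charge_count_unfold:
  assumes pos: "0 < d" "0 < h" "0 < p" and \<kappa>: "unfolds d h p \<kappa>"
  shows "charge_count (h * p) (d * p) \<kappa> i = charge_count h d \<kappa> i"
proof -
  let ?A = "{c. c < d * p \<and> [\<kappa> c = i] (mod int (h * p))}"
  let ?B = "{(z, k). z \<in> {..<d} \<and> k < p \<and> [\<kappa> z + int (h * k) = i] (mod int (h * p))}"
  have eq: "[\<kappa> c = i] (mod int (h * p)) \<longleftrightarrow> [\<kappa> (c mod d) + int (h * (c div d)) = i] (mod int (h * p))"
    if "c < d * p" for c
    using \<kappa> that unfolding unfolds_def cong_def by simp
  have bound: "z + d * k < d * p" if "z < d" "k < p" for z k
    using that by (metis add_less_cancel_right less_le_trans mult_Suc_right mult_le_mono2 Suc_leI)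
  have "bij_betw (\<lambda>c. (c mod d, c div d)) ?A ?B"
  proof (rule bij_betw_byWitness[where f' = "\<lambda>(z, k). z + d * k"])
    show "(\<lambda>c. (c mod d, c div d)) ` ?A \<subseteq> ?B"
      using eq pos by (auto simp: less_mult_imp_div_less mult.commute)
    show "(\<lambda>(z, k). z + d * k) ` ?B \<subseteq> ?A"
      using eq bound pos by auto
  qed (use pos in auto)
  then have "card ?A = card ?B" by (rule bij_betw_same_card)
  also have "\<dots> = card {z \<in> {..<d}. [\<kappa> z = i] (mod int h)}"
    by (rule card_unfold_residues[OF pos(2,3)])
  finally show ?thesis by (simp add: charge_count_def)
qed

text \<open>
  The repeated components spread each residue modulo \<open>h\<close> evenly over its \<open>p\<close> lifts, so a single
  function counts the nodes of \<open>Z\<close> modulo \<open>h\<close> and those of the unfolded diagram modulo \<open>h p\<close>.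
\<close>

lemma unfold_diagram:
  assumes pos: "0 < d" "0 < h" "0 < p" and \<kappa>: "unfolds d h p \<kappa>" and Z: "diagram d Z"
  shows "diagram (d * p) (unfold_diagram d p Z)"
    and "node_count (h * p) \<kappa> (unfold_diagram d p Z) = node_count h \<kappa> Z"
proof -
  let ?Y = "unfold_diagram d p Z"
  have bound: "z + d * k < d * p" if "z < d" "k < p" for z k
    using that by (metis add_less_cancel_right less_le_trans mult_Suc_right mult_le_mono2 Suc_leI)
  let ?split = "\<lambda>(a, b, c). ((a, b, c mod d), c div d) :: node \<times> nat"
  let ?join = "\<lambda>((a, b, c), k). (a, b, c + d * k) :: node"
  have "?Y \<subseteq> ?join ` (Z \<times> {..<p})"
  proof
    fix y assume y: "y \<in> ?Y"
    obtain a b c where abc: "y = (a, b, c)" by (cases y)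
    have "y = ?join ((a, b, c mod d), c div d)" by (simp add: abc)
    moreover have "((a, b, c mod d), c div d) \<in> Z \<times> {..<p}"
      using y by (simp add: abc unfold_diagram_def less_mult_imp_div_less mult.commute)
    ultimately show "y \<in> ?join ` (Z \<times> {..<p})" by (rule image_eqI)
  qed
  then have "finite ?Y"
    by (rule finite_subset) (use diagram_finite[OF Z] in simp)
  then show "diagram (d * p) ?Y"
    using diagram_down[OF Z] unfolding diagram_def unfold_diagram_def by blast
  show "node_count (h * p) \<kappa> ?Y = node_count h \<kappa> Z"
  proof
    fix i
    let ?A = "{\<gamma>\<in>?Y. [content \<kappa> \<gamma> = i] (mod int (h * p))}"
    let ?B = "{(z, k). z \<in> Z \<and> k < p \<and> [content \<kappa> z + int (h * k) = i] (mod int (h * p))}"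
    have eq: "[int b - int a + \<kappa> c = i] (mod int (h * p))
        \<longleftrightarrow> [int b - int a + \<kappa> (c mod d) + int (h * (c div d)) = i] (mod int (h * p))"
      if "c < d * p" for a b c :: nat
    proof -
      have "[int b - int a + \<kappa> c = int b - int a + (\<kappa> (c mod d) + int (h * (c div d)))] (mod int (h * p))"
        using \<kappa> that unfolding unfolds_def by (intro cong_add) auto
      then show ?thesis by (simp add: cong_def add.assoc)
    qed
    have "bij_betw ?split ?A ?B"
    proof (rule bij_betw_byWitness[where f' = ?join])
      show "?split ` ?A \<subseteq> ?B"
        using eq pos by (auto simp: unfold_diagram_def less_mult_imp_div_less mult.commute)
      show "?join ` ?B \<subseteq> ?A"
      proof
        fix y assume "y \<in> ?join ` ?B"
        then obtain a b c k where y: "y = (a, b, c + d * k)" and z: "(a, b, c) \<in> Z" and k: "k < p"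
          and i: "[content \<kappa> (a, b, c) + int (h * k) = i] (mod int (h * p))" by auto
        have c: "c < d" using diagram_component[OF Z z] .
        then show "y \<in> ?A"
          using z i eq[OF bound[OF c k], of b a] bound[OF c k] by (simp add: y unfold_diagram_def)
      qed
    qed (use pos diagram_component[OF Z] in auto)
    then have "card ?A = card ?B" by (rule bij_betw_same_card)
    also have "\<dots> = card {z \<in> Z. [content \<kappa> z = i] (mod int h)}"
      by (rule card_unfold_residues[OF pos(2,3)])
    finally show "node_count (h * p) \<kappa> ?Y i = node_count h \<kappa> Z i" by (simp add: node_count_def)
  qed
qed

section \<open>Realizing periodic residue counts by periodic diagrams\<close>

text \<open>
  The two systems, \<open>d\<close> charges modulo \<open>h\<close> and \<open>d p\<close> charges modulo \<open>h p\<close>, give the same hubs. If these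
  are nonnegative, \<open>f\<close> is dominant for the small system and so realizable there. Otherwise choose \<open>i\<close>
  with negative hub. The residues congruent to \<open>i\<close> modulo \<open>h\<close> are pairwise nonadjacent, and the product
  of their reflections in the large system is the reflection at \<open>i\<close> in the small one. Apply it in the
  large system, where \<open>f\<close> is known to be realizable: the result is again \<open>h\<close>-periodic, and smaller,
  hence realizable in the small system by induction. Reflecting back there recovers \<open>f\<close>.
\<close>

lemma realizable_fold:
  assumes pos: "0 < d" "0 < h" "0 < p" and \<kappa>: "unfolds d h p \<kappa>"
    and "realizable (h * p) (d * p) \<kappa> f" and "\<And>i j. [i = j] (mod int h) \<Longrightarrow> f i = f j"
  shows "realizable h d \<kappa> f"
  using assms(5,6)
proof (induction "nat (sum f {0..<int h})" arbitrary: f rule: less_induct)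
  case less
  note f = less.prems(1) and per = less.prems(2)
  have hub: "hub (h * p) (d * p) \<kappa> g = hub h d \<kappa> g" for g
    by (simp add: hub_def charge_count_unfold[OF pos \<kappa>] fun_eq_iff)
  show ?case
  proof (cases "\<forall>i. 0 \<le> hub h d \<kappa> f i")
    case True
    then show ?thesis
      by (intro realizable_of_dominant[OF pos(2,1)] per realizable_nonneg[OF f]) auto
  next
    case False
    then obtain i where i: "hub h d \<kappa> f i < 0" by (auto simp: not_le)
    \<comment> \<open>For h = 1 all residues agree, so the second difference of f vanishes and no hub is negative.\<close>
    have "h \<noteq> 1"
    proof
      assume "h = 1"
      then have "f (i - 1) = f i" "f (i + 1) = f i" by (auto intro: per)
      then show False using i by (simp add: hub_def charge_count_def)
    qed
    have adj: "\<not> [j - 1 = i] (mod int h)" "\<not> [j + 1 = i] (mod int h)" if "[j = i] (mod int h)" for j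
    proof -
      have "int h dvd 1" if "[j - 1 = i] (mod int h) \<or> [j + 1 = i] (mod int h)"
      proof -
        have "int h dvd j - i" using \<open>[j = i] (mod int h)\<close> by (simp add: cong_iff_dvd_diff)
        moreover have "int h dvd j - 1 - i \<or> int h dvd j + 1 - i"
          using that by (simp add: cong_iff_dvd_diff)
        ultimately have "int h dvd (j - i) - (j - 1 - i) \<or> int h dvd (j + 1 - i) - (j - i)"
          by (meson dvd_diff)
        then show ?thesis by simp
      qed
      moreover have "\<not> int h dvd 1" using \<open>h \<noteq> 1\<close> by (simp add: zdvd1_eq)
      ultimately show "\<not> [j - 1 = i] (mod int h)" "\<not> [j + 1 = i] (mod int h)" by blast+
    qed
    \<comment> \<open>The amount by which the reflection at i lowers the counts.\<close>
    define k where "k j = (if [j = i] (mod int h) then - hub h d \<kappa> f i else 0)" for j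
    have kper: "k j = k l" if "[j = l] (mod int h)" for j l
      using that by (auto simp: k_def cong_def)
    have at_i: "hub h d \<kappa> f j = hub h d \<kappa> f i" if "[j = i] (mod int h)" for j
      using per[OF that] per[of "j - 1" "i - 1"] per[of "j + 1" "i + 1"] that
      by (simp add: hub_def charge_count_def cong_diff cong_add) (simp add: cong_def)
    have lower: "realizable (h * p) (d * p) \<kappa> (\<lambda>j. f j - k j)"
    proof (rule realizable_lower[OF f])
      show "0 < h * p" using pos by simp
      show "k j = k l" if "[j = l] (mod int (h * p))" for j l
        by (rule kper, rule cong_dvd_modulus[OF that]) simp
      show "0 \<le> k j \<and> k j \<le> max 0 (- hub (h * p) (d * p) \<kappa> f j)" for j
        using at_i[of j] i by (auto simp: k_def hub)
    qed
    have per': "f j - k j = f l - k l" if "[j = l] (mod int h)" for j l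
      using per[OF that] kper[OF that] by simp
    have "(\<Sum>j\<in>{0..<int h}. f j - k j) < sum f {0..<int h}"
      by (rule sum_period_less[OF pos(2), where i = i]) (use per per' i in \<open>auto simp: k_def\<close>)
    moreover have "0 \<le> (\<Sum>j\<in>{0..<int h}. f j - k j)"
      using realizable_nonneg[OF lower] by (intro sum_nonneg) auto
    ultimately have fold: "realizable h d \<kappa> (\<lambda>j. f j - k j)"
      by (intro less.hyps[OF _ lower per']) auto
    have "realizable h d \<kappa> (\<lambda>j. f j - k j + k j)"
    proof (rule realizable_raise[OF fold pos(2) kper])
      show "0 \<le> k j \<and> k j \<le> max 0 (hub h d \<kappa> (\<lambda>j. f j - k j) j)" for j
      proof (cases "[j = i] (mod int h)")
        case True
        then show ?thesis
          using adj[OF True] at_i[OF True] i by (simp add: hub_diff) (simp add: k_def)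
      qed (simp add: k_def)
    qed
    then show ?thesis by simp
  qed
qed

section \<open>Diagrams as \<open>r\<close>-partitions\<close>

definition partition_of :: "(nat \<times> nat) set \<Rightarrow> nat list" where
  "partition_of S = map (\<lambda>a. card {b. (a, b) \<in> S}) [0..<card {a. (a, 0) \<in> S}]"

lemma down_closed_eq_lessThan_card:
  fixes X :: "nat set"
  assumes "finite X" and "\<And>x y. x \<in> X \<Longrightarrow> y \<le> x \<Longrightarrow> y \<in> X"
  shows "x \<in> X \<longleftrightarrow> x < card X"
proof -
  have "X = {..<Suc (Max X)}" if "X \<noteq> {}"
    using assms(1) assms(2)[OF Max_in[OF assms(1) that]] by (auto simp: less_Suc_eq_le)
  then have "\<exists>n. X = {..<n}" by (cases "X = {}") auto
  then show ?thesis by auto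
qed

lemma partition_of_correct:
  assumes fin: "finite S" and down: "\<And>a b a' b'. (a, b) \<in> S \<Longrightarrow> a' \<le> a \<Longrightarrow> b' \<le> b \<Longrightarrow> (a', b') \<in> S"
  shows "is_partition (partition_of S)" and "young (partition_of S) = S"
proof -
  define h where "h = card {a. (a, 0) \<in> S}"
  define w where "w a = card {b. (a, b) \<in> S}" for a
  have "finite {a. (a, 0) \<in> S}"
    by (rule finite_subset[of _ "fst ` S"]) (use fin in \<open>force+\<close>)
  then have col: "(a, 0) \<in> S \<longleftrightarrow> a < h" for a
    unfolding h_def using down_closed_eq_lessThan_card[of "{a. (a, 0) \<in> S}" a] down by auto
  have finrow: "finite {b. (a, b) \<in> S}" for a
    by (rule finite_subset[of _ "snd ` S"]) (use fin in \<open>force+\<close>)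
  then have row: "(a, b) \<in> S \<longleftrightarrow> b < w a" for a b
    unfolding w_def using down_closed_eq_lessThan_card[of "{b. (a, b) \<in> S}" b] down by auto
  have eq: "partition_of S = map w [0..<h]" by (simp add: partition_of_def h_def w_def)
  have pos: "a < h \<longleftrightarrow> 0 < w a" for a using row[of a 0] col[of a] by simp
  have "a < h" if "b < w a" for a b using that pos by auto
  then show "young (partition_of S) = S"
    by (auto simp: young_def eq row)
  have "w a' \<le> w a" if "a \<le> a'" for a a'
    unfolding w_def using finrow down that by (intro card_mono) auto
  then have "sorted_wrt (\<ge>) (map w [0..<h])"
    by (simp add: sorted_wrt_iff_nth_less)
  then show "is_partition (partition_of S)"
    using pos by (auto simp: is_partition_def eq)
qed

lemma diagram_young_multi:
  assumes "is_rpartition r L"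
  shows "diagram r (young_multi L)"
proof -
  have mono: "L ! c ! a \<le> L ! c ! a'" if "c < length L" "a < length (L ! c)" "a' \<le> a" for c a a'
  proof (cases "a' = a")
    case False
    have "sorted_wrt (\<ge>) (L ! c)"
      using assms that(1) by (auto simp: is_rpartition_def is_partition_def)
    then show ?thesis using that False by (auto simp: sorted_wrt_iff_nth_less)
  qed simp
  have "(a', b', c) \<in> young_multi L" if "(a, b, c) \<in> young_multi L" "a' \<le> a" "b' \<le> b" for a b c a' b'
    using that mono[of c a a'] by (auto simp: young_multi_def young_def)
  moreover have "c < r" if "(a, b, c) \<in> young_multi L" for a b c
    using that assms by (simp add: young_multi_def is_rpartition_def)
  ultimately show ?thesis
    unfolding diagram_def using finite_young_multi by blast
qed

definition rpartition_of :: "nat \<Rightarrow> node set \<Rightarrow> nat list list" where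
  "rpartition_of r Y = map (\<lambda>c. partition_of {(a, b). (a, b, c) \<in> Y}) [0..<r]"

lemma rpartition_of_correct:
  assumes Y: "diagram r Y"
  shows "is_rpartition r (rpartition_of r Y)" and "young_multi (rpartition_of r Y) = Y"
proof -
  have fin: "finite {(a, b). (a, b, c) \<in> Y}" for c
    by (rule finite_subset[of _ "(\<lambda>(a, b, c). (a, b)) ` Y"])
      (use diagram_finite[OF Y] in \<open>force+\<close>)
  note correct = partition_of_correct[OF fin]
  have "is_partition (partition_of {(a, b). (a, b, c) \<in> Y})"
    and eq: "young (partition_of {(a, b). (a, b, c) \<in> Y}) = {(a, b). (a, b, c) \<in> Y}" for c
    by (rule correct; use diagram_down[OF Y] in blast)+
  then show "is_rpartition r (rpartition_of r Y)"
    by (auto simp: is_rpartition_def rpartition_of_def)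
  show "young_multi (rpartition_of r Y) = Y"
    using diagram_component[OF Y] by (auto simp: young_multi_def rpartition_of_def eq)
qed

section \<open>Residue counts as elements of the root lattice\<close>

lemma residue_content: "residue e \<kappa> \<gamma> = content ((!) \<kappa>) \<gamma> mod int e"
  by (cases \<gamma>) (simp add: residue_def)

lemma lookup_alpha_of:
  assumes "0 \<le> i" "i < int e"
  shows "Poly_Mapping.lookup (alpha_of e \<kappa> L) i = node_count e ((!) \<kappa>) (young_multi L) i"
proof -
  have "i = content ((!) \<kappa>) \<gamma> mod int e \<longleftrightarrow> [content ((!) \<kappa>) \<gamma> = i] (mod int e)" for \<gamma>
    using assms by (auto simp: cong_def)
  then show ?thesis
    by (simp add: alpha_of_def lookup_sum node_count_def card_filter_eq_sum finite_young_multi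
        residue_content of_bool_def)
qed

lemma keys_alpha_of: "0 < e \<Longrightarrow> Poly_Mapping.keys (alpha_of e \<kappa> L) \<subseteq> {0..<int e}"
proof -
  assume "0 < e"
  have "Poly_Mapping.keys (alpha_of e \<kappa> L)
      \<subseteq> (\<Union>\<gamma>\<in>young_multi L. Poly_Mapping.keys (frag_of (residue e \<kappa> \<gamma>)))"
    unfolding alpha_of_def by (rule Poly_Mapping.keys_sum)
  then show ?thesis using \<open>0 < e\<close> by (auto simp: residue_content)
qed

lemma alpha_of_eqI:
  assumes "0 < e" and "node_count e ((!) \<kappa>) (young_multi L) = node_count e ((!) \<kappa>) (young_multi M)"
  shows "alpha_of e \<kappa> L = alpha_of e \<kappa> M"
proof (rule poly_mapping_eqI)
  fix i
  show "Poly_Mapping.lookup (alpha_of e \<kappa> L) i = Poly_Mapping.lookup (alpha_of e \<kappa> M) i"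
  proof (cases "0 \<le> i \<and> i < int e")
    case False
    then have "i \<notin> Poly_Mapping.keys (alpha_of e \<kappa> L)" "i \<notin> Poly_Mapping.keys (alpha_of e \<kappa> M)"
      using keys_alpha_of[OF assms(1)] by fastforce+
    then show ?thesis by (simp add: in_keys_iff)
  qed (simp add: lookup_alpha_of assms(2))
qed

lemma shift_Q_funpow_alpha_of:
  assumes "0 < e"
  shows "(shift_Q \<eta> e ^^ j) (alpha_of e \<kappa> L)
    = (\<Sum>\<gamma>\<in>young_multi L. frag_of ((content ((!) \<kappa>) \<gamma> + int j * int \<eta>) mod int e))"
  unfolding shift_Q_funpow[OF keys_alpha_of[OF assms]]
  by (simp add: alpha_of_def frag_extend_sum finite_young_multi o_def residue_content mod_simps)

lemma node_count_shift_invariant: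
  assumes "0 < e" and inv: "(shift_Q \<eta> e ^^ j) (alpha_of e \<kappa> L) = alpha_of e \<kappa> L"
  shows "node_count e ((!) \<kappa>) (young_multi L) (i - int j * int \<eta>)
    = node_count e ((!) \<kappa>) (young_multi L) i"
proof -
  let ?f = "node_count e ((!) \<kappa>) (young_multi L)"
  have i: "0 \<le> i mod int e" "i mod int e < int e" using assms(1) by simp_all
  have "i mod int e = (content ((!) \<kappa>) \<gamma> + int j * int \<eta>) mod int e
      \<longleftrightarrow> [content ((!) \<kappa>) \<gamma> = i - int j * int \<eta>] (mod int e)" for \<gamma>
    by (simp add: cong_iff_dvd_diff mod_eq_dvd_iff algebra_simps)
       (metis (no_types, opaque_lifting) add.commute dvd_diff_commute diff_diff_eq2)
  then have "?f (i - int j * int \<eta>)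
      = Poly_Mapping.lookup ((shift_Q \<eta> e ^^ j) (alpha_of e \<kappa> L)) (i mod int e)"
    by (simp add: shift_Q_funpow_alpha_of[OF assms(1)] lookup_sum node_count_def
        card_filter_eq_sum finite_young_multi of_bool_def)
  also have "\<dots> = ?f (i mod int e)" by (simp add: inv lookup_alpha_of[OF i])
  also have "\<dots> = ?f i" by (rule node_count_cong) (simp add: cong_def)
  finally show ?thesis .
qed

lemma periodic_int_multiple:
  fixes f :: "int \<Rightarrow> 'a"
  assumes "\<And>i. f (i - t) = f i"
  shows "f (i + n * t) = f i"
proof -
  have *: "f (i + int m * t) = f i" for m i
  proof (induction m)
    case (Suc m)
    then show ?case using assms[of "i + int (Suc m) * t"] by (simp add: algebra_simps)
  qed simp
  show ?thesis
    using *[of i "nat n"] *[of "i + n * t" "nat (- n)"] by (cases "0 \<le> n") auto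
qed

text \<open>
  Bezout: the periods of a function form a subgroup of the integers.
\<close>

lemma periodic_gcd:
  fixes f :: "int \<Rightarrow> 'a"
  assumes "\<And>i. f (i - s) = f i" "\<And>i. f (i - t) = f i" and "[i = j] (mod gcd s t)"
  shows "f i = f j"
proof -
  obtain q where q: "i = j + gcd s t * q"
    using assms(3) by (metis cong_iff_lin cong_sym mult.commute)
  obtain u v where "u * s + v * t = gcd s t" using bezout_int by blast
  then have "i = j + (u * q) * s + (v * q) * t" by (simp add: q algebra_simps flip: distrib_left)
  then show ?thesis
    using periodic_int_multiple[of f, OF assms(1)] periodic_int_multiple[of f, OF assms(2)] by simp
qed

section \<open>Fixed \<open>r\<close>-partitions in fixed blocks\<close>

text \<open>
  The factor \<open>g\<close> allows the powers of the shift: \<open>\<sigma>\<^sup>g\<close> moves components by \<open>d g\<close> and residues by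
  \<open>\<eta> g\<close>.
\<close>

lemma unfolds_of_compatible:
  assumes pos: "0 < d" and \<kappa>: "compatible d \<eta> (g * p) \<kappa>"
  shows "unfolds (d * g) (\<eta> * g) p ((!) \<kappa>)"
  unfolding unfolds_def
proof (intro allI impI)
  have step: "[\<kappa> ! (c + k * d) = \<kappa> ! c + int k * int \<eta>] (mod int (\<eta> * (g * p)))"
    if "c + k * d < d * (g * p)" for c k
    using that
  proof (induction k)
    case (Suc k)
    then have lt: "c + k * d < d * (g * p)" by simp
    have "\<kappa> ! ((c + k * d + d) mod (d * (g * p)))
        = (\<kappa> ! (c + k * d) + int \<eta>) mod int (\<eta> * (g * p))"
      using \<kappa> lt unfolding compatible_def by blast
    moreover have "(c + k * d + d) mod (d * (g * p)) = c + Suc k * d"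
      using Suc.prems by (simp add: add.commute add.left_commute)
    ultimately have "[\<kappa> ! (c + Suc k * d) = \<kappa> ! (c + k * d) + int \<eta>] (mod int (\<eta> * (g * p)))"
      by (simp add: cong_def)
    also have "[\<kappa> ! (c + k * d) + int \<eta> = \<kappa> ! c + int k * int \<eta> + int \<eta>] (mod int (\<eta> * (g * p)))"
      using Suc.IH[OF lt] by (rule cong_add) simp
    finally show ?case by (simp add: algebra_simps)
  qed simp
  fix c assume c: "c < d * g * p"
  have "c = c mod (d * g) + g * (c div (d * g)) * d"
    by (metis mod_mult_div_eq mult.assoc mult.commute)
  then show "[\<kappa> ! c = \<kappa> ! (c mod (d * g)) + int (\<eta> * g * (c div (d * g)))] (mod int (\<eta> * g * p))"
    using step[of "c mod (d * g)" "g * (c div (d * g))"] c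
    by (simp add: mult.assoc mult.commute mult.left_commute)
qed

lemma shift_rpart_funpow:
  assumes "0 < d" and "d \<le> length L"
  shows "(shift_rpart d ^^ n) L = rotate (n * (length L - d)) L"
proof (induction n)
  case (Suc n)
  then show ?case using assms by (simp add: shift_rpart_eq_rotate rotate_rotate)
qed simp


text \<open>
  The order of the shift divides \<open>p\<close>, so in the group it generates the subgroup generated by the
  \<open>j\<close>-th power is that of the \<open>gcd j p\<close>-th power.
\<close>

lemma periodic_tuple_fixed:
  assumes "0 < d" "0 < p" and len: "length M = d * p"
    and per: "\<And>c. c < d * p \<Longrightarrow> M ! c = M ! (c mod (d * gcd j p))"
  shows "(shift_rpart d ^^ j) M = M"
proof (rule nth_equalityI)
  have le: "d \<le> length M" using assms by simp
  note shift = shift_rpart_funpow[OF \<open>0 < d\<close> le, of j]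
  show "length ((shift_rpart d ^^ j) M) = length M" by (simp add: shift)
  fix c assume "c < length ((shift_rpart d ^^ j) M)"
  then have c: "c < d * p" by (simp add: shift len)
  let ?D = "d * gcd j p"
  have "?D dvd d * p" by simp
  have "j * (d * p - d) = (d * j) * (p - 1)" by (simp add: algebra_simps diff_mult_distrib2)
  then have "?D dvd j * (d * p - d)" by (metis dvd_mult2 gcd_dvd1 mult_dvd_mono dvd_refl)
  then have "(j * (d * p - d) + c) mod (d * p) mod ?D = c mod ?D"
    using \<open>?D dvd d * p\<close> by (metis mod_mod_cancel mod_add_left_eq add_0 dvd_imp_mod_0)
  moreover have "(shift_rpart d ^^ j) M ! c = M ! ((j * (d * p - d) + c) mod (d * p))"
    unfolding shift using c by (simp add: nth_rotate len)
  ultimately show "(shift_rpart d ^^ j) M ! c = M ! c"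
    using per[of "(j * (d * p - d) + c) mod (d * p)"] per[OF c] assms by simp
qed

text \<open>
  Invariance of the block under \<open>\<sigma>\<^sup>j\<close> makes its residue counts periodic modulo \<open>\<eta> g\<close> with
  \<open>g = gcd j p\<close>. By \<open>realizable_fold\<close> they are realized by \<open>d g\<close> components with residues modulo \<open>\<eta> g\<close>,
  and unfolding these gives the fixed \<open>r\<close>-partition.
\<close>

theorem fixed_rpartition_of_fixed_block:
  assumes pos: "0 < d" "0 < \<eta>" "0 < p" and \<kappa>: "compatible d \<eta> p \<kappa>"
    and L: "is_rpartition (d * p) L"
    and inv: "(shift_Q \<eta> (\<eta> * p) ^^ j) (alpha_of (\<eta> * p) \<kappa> L) = alpha_of (\<eta> * p) \<kappa> L"
  shows "\<exists>M. is_rpartition (d * p) M \<and> alpha_of (\<eta> * p) \<kappa> M = alpha_of (\<eta> * p) \<kappa> L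
    \<and> (shift_rpart d ^^ j) M = M"
proof -
  define g where "g = gcd j p"
  define q where "q = p div g"
  have g: "0 < g" and p: "p = g * q" using pos by (simp_all add: g_def q_def)
  then have q: "0 < q" using pos by (cases "q = 0") auto
  have e: "0 < \<eta> * p" using pos by simp
  let ?f = "node_count (\<eta> * p) ((!) \<kappa>) (young_multi L)"
  have unf: "unfolds (d * g) (\<eta> * g) q ((!) \<kappa>)"
    using unfolds_of_compatible[OF pos(1), of \<eta> g q \<kappa>] \<kappa> p by simp
  have per: "?f i = ?f i'" if "[i = i'] (mod int (\<eta> * g))" for i i'
  proof (rule periodic_gcd[of ?f "int j * int \<eta>" "int (\<eta> * p)"])
    show "?f (i - int j * int \<eta>) = ?f i" for i by (rule node_count_shift_invariant[OF e inv])
    show "?f (i - int (\<eta> * p)) = ?f i" for i by (rule node_count_cong) (simp add: cong_def)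
    have "gcd (int j * int \<eta>) (int (\<eta> * p)) = int (\<eta> * g)"
      by (simp add: g_def gcd_mult_distrib_nat mult.commute flip: gcd_int_int_eq of_nat_mult)
    then show "[i = i'] (mod gcd (int j * int \<eta>) (int (\<eta> * p)))" using that by simp
  qed
  have "realizable (\<eta> * g * q) (d * g * q) ((!) \<kappa>) ?f"
    using diagram_young_multi[OF L] p unfolding realizable_def by (auto simp: mult.assoc)
  then have "realizable (\<eta> * g) (d * g) ((!) \<kappa>) ?f"
    using pos g q by (intro realizable_fold[OF _ _ _ unf] per) auto
  then obtain Z where Z: "diagram (d * g) Z" and f: "node_count (\<eta> * g) ((!) \<kappa>) Z = ?f"
    by (auto simp: realizable_def)
  define Y where "Y = unfold_diagram (d * g) q Z"
  have Y: "diagram (d * p) Y" "node_count (\<eta> * p) ((!) \<kappa>) Y = ?f"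
    using unfold_diagram[OF _ _ q unf Z] pos g f by (simp_all add: Y_def p mult.assoc)
  let ?M = "rpartition_of (d * p) Y"
  have M: "?M ! c = partition_of {(a, b). (a, b, c mod (d * g)) \<in> Z}" if "c < d * p" for c
    using that p by (simp add: rpartition_of_def Y_def unfold_diagram_def mult.assoc)
  have "?M ! c = ?M ! (c mod (d * gcd j p))" if c: "c < d * p" for c
  proof -
    have "c mod (d * g) < d * p" using c by (meson le_less_trans mod_less_eq_dividend)
    then show ?thesis using c by (simp add: M flip: g_def)
  qed
  then have "(shift_rpart d ^^ j) ?M = ?M"
    using pos by (intro periodic_tuple_fixed) (auto simp: rpartition_of_def)
  moreover have "alpha_of (\<eta> * p) \<kappa> ?M = alpha_of (\<eta> * p) \<kappa> L"
    using e by (rule alpha_of_eqI) (simp add: rpartition_of_correct[OF Y(1)] Y(2))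
  ultimately show ?thesis using rpartition_of_correct(1)[OF Y(1)] by auto
qed

section \<open>Orbits\<close>

lemma alpha_of_shift_rpart:
  assumes pos: "0 < d" "0 < \<eta>" "0 < p" and \<kappa>: "compatible d \<eta> p \<kappa>" and len: "length L = d * p"
  shows "alpha_of (\<eta> * p) \<kappa> (shift_rpart d L) = shift_Q \<eta> (\<eta> * p) (alpha_of (\<eta> * p) \<kappa> L)"
proof -
  let ?r = "d * p" and ?e = "\<eta> * p"
  have dr: "d \<le> ?r" using pos by simp
  define s where "s = ?r - d"
  let ?up = "\<lambda>(a, b, c). (a, b, (c + d) mod ?r) :: node"
  let ?down = "\<lambda>(a, b, c). (a, b, (c + s) mod ?r) :: node"
  have nth: "shift_rpart d L ! c = L ! ((c + s) mod ?r)" if "c < ?r" for c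
    using that shift_rpart_eq_rotate[of d L] pos dr by (simp add: len nth_rotate add.commute s_def)
  have len': "length (shift_rpart d L) = ?r" by (simp add: shift_rpart_def len dr)
  have r: "0 < ?r" using pos by simp
  have ud: "((c + s) mod ?r + d) mod ?r = c" "((c + d) mod ?r + s) mod ?r = c"
    if "c < ?r" for c
  proof -
    have "((c + s) mod ?r + d) mod ?r = (c + (s + d)) mod ?r"
      "((c + d) mod ?r + s) mod ?r = (c + (d + s)) mod ?r"
      by (simp_all only: mod_add_left_eq add.assoc)
    moreover have "s + d = ?r" "d + s = ?r" using dr by (simp_all add: s_def)
    ultimately show "((c + s) mod ?r + d) mod ?r = c" "((c + d) mod ?r + s) mod ?r = c"
      using that by simp_all
  qed
  have "bij_betw ?up (young_multi L) (young_multi (shift_rpart d L))"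
  proof (rule bij_betw_byWitness[where f' = ?down])
    show "?up ` young_multi L \<subseteq> young_multi (shift_rpart d L)"
      using r by (auto simp: young_multi_def len len' nth ud)
    show "?down ` young_multi (shift_rpart d L) \<subseteq> young_multi L"
      using r by (auto simp: young_multi_def len len' nth)
  qed (auto simp: young_multi_def len len' ud)
  then have "alpha_of ?e \<kappa> (shift_rpart d L)
      = (\<Sum>\<gamma>\<in>young_multi L. frag_of (residue ?e \<kappa> (?up \<gamma>)))"
    unfolding alpha_of_def by (rule sum.reindex_bij_betw[symmetric])
  also have "\<dots> = (\<Sum>\<gamma>\<in>young_multi L. frag_of ((residue ?e \<kappa> \<gamma> + int \<eta>) mod int ?e))"
  proof (intro sum.cong arg_cong[of _ _ frag_of] refl)
    fix \<gamma> assume \<gamma>: "\<gamma> \<in> young_multi L"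
    obtain a b c where abc: "\<gamma> = (a, b, c)" by (cases \<gamma>)
    have "\<kappa> ! ((c + d) mod ?r) = (\<kappa> ! c + int \<eta>) mod int ?e"
      using \<gamma> \<kappa> by (auto simp: abc young_multi_def len compatible_def)
    then show "residue ?e \<kappa> (?up \<gamma>) = (residue ?e \<kappa> \<gamma> + int \<eta>) mod int ?e"
      by (simp add: abc residue_def mod_simps add.assoc)
  qed
  also have "\<dots> = shift_Q \<eta> ?e (alpha_of ?e \<kappa> L)"
    by (simp add: shift_Q_def alpha_of_def frag_extend_sum finite_young_multi o_def)
  finally show ?thesis .
qed

lemma alpha_of_shift_rpart_funpow:
  assumes pos: "0 < d" "0 < \<eta>" "0 < p" and \<kappa>: "compatible d \<eta> p \<kappa>" and len: "length L = d * p"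
  shows "alpha_of (\<eta> * p) \<kappa> ((shift_rpart d ^^ n) L)
    = (shift_Q \<eta> (\<eta> * p) ^^ n) (alpha_of (\<eta> * p) \<kappa> L)"
proof (induction n)
  case (Suc n)
  have "length ((shift_rpart d ^^ n) L) = d * p"
    using shift_rpart_funpow[OF pos(1), of L n] pos len by simp
  then show ?case using alpha_of_shift_rpart[OF pos \<kappa>] Suc.IH by simp
qed simp

lemma funpow_card_orbit:
  assumes "0 < p" and "(f ^^ p) x = x"
  shows "0 < card (orbit f x)" and "(f ^^ card (orbit f x)) x = x"
proof -
  have x: "x \<in> orbit f x" using assms unfolding orbit_altdef by force
  have "card (orbit f x) = funpow_dist1 f x x"
    using orbit_conv_funpow_dist1[OF x] inj_on_funpow_dist1[OF x] by (metis card_image card_atLeastLessThan diff_zero)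
  then show "0 < card (orbit f x)" "(f ^^ card (orbit f x)) x = x"
    using funpow_dist1_prop[OF x] by simp_all
qed

text \<open>
  By equivariance the orbit of an \<open>r\<close>-partition maps onto the orbit of its block.
\<close>

lemma card_orbit_alpha_of_le:
  assumes pos: "0 < d" "0 < \<eta>" "0 < p" and \<kappa>: "compatible d \<eta> p \<kappa>" and len: "length L = d * p"
  shows "card (orbit (shift_Q \<eta> (\<eta> * p)) (alpha_of (\<eta> * p) \<kappa> L)) \<le> card (orbit (shift_rpart d) L)"
proof -
  have "orbit (shift_Q \<eta> (\<eta> * p)) (alpha_of (\<eta> * p) \<kappa> L)
      \<subseteq> alpha_of (\<eta> * p) \<kappa> ` orbit (shift_rpart d) L"
    unfolding orbit_altdef using alpha_of_shift_rpart_funpow[OF assms, symmetric] by auto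
  moreover have "finite (orbit (shift_rpart d) L)"
    using orbit_of_period[OF pos(3) shift_rpart_period[OF pos(1,3) len]] by simp
  ultimately show ?thesis using surj_card_le by blast
qed

theorem corollary2p33:
  fixes d \<eta> p e r :: nat and \<kappa> :: "int list"
  assumes "1 \<le> d" and "1 \<le> \<eta>" and "1 \<le> p"
    and "e = \<eta> * p" and "2 \<le> e" and "r = d * p"
    and "multicharge e r \<kappa>" and "compatible d \<eta> p \<kappa>"
  shows "(\<forall>\<alpha>\<in>Q_plus e. rpartitions_of e r \<kappa> \<alpha> \<noteq> {} \<longrightarrow>
            card (orbit (shift_Q \<eta> e) \<alpha>)
              \<in> (\<lambda>L. card (orbit (shift_rpart d) L)) ` rpartitions_of e r \<kappa> \<alpha> \<and>
            (\<forall>n \<in> (\<lambda>L. card (orbit (shift_rpart d) L)) ` rpartitions_of e r \<kappa> \<alpha>.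
               card (orbit (shift_Q \<eta> e) \<alpha>) \<le> n))
       \<and> (\<forall>L j. is_rpartition r L \<and> j < p \<and>
            (shift_Q \<eta> e ^^ j) (alpha_of e \<kappa> L) = alpha_of e \<kappa> L \<longrightarrow>
            (\<exists>M. is_rpartition r M \<and> alpha_of e \<kappa> M = alpha_of e \<kappa> L \<and>
                 (shift_rpart d ^^ j) M = M))"
proof (intro conjI ballI allI impI)
  have pos: "0 < d" "0 < \<eta>" "0 < p" and er: "e = \<eta> * p" "r = d * p" and \<kappa>: "compatible d \<eta> p \<kappa>"
    using assms by simp_all
  note fixed = fixed_rpartition_of_fixed_block[OF pos \<kappa>, folded er]
  have le: "card (orbit (shift_Q \<eta> e) \<alpha>) \<le> card (orbit (shift_rpart d) L)"
    if "L \<in> rpartitions_of e r \<kappa> \<alpha>" for L \<alpha>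
    using card_orbit_alpha_of_le[OF pos \<kappa>, of L] that
    by (auto simp: er rpartitions_of_def is_rpartition_def)
  show "\<exists>M. is_rpartition r M \<and> alpha_of e \<kappa> M = alpha_of e \<kappa> L \<and> (shift_rpart d ^^ j) M = M"
    if "is_rpartition r L \<and> j < p \<and> (shift_Q \<eta> e ^^ j) (alpha_of e \<kappa> L) = alpha_of e \<kappa> L" for L j
    using fixed that by blast
  fix \<alpha> assume \<alpha>: "rpartitions_of e r \<kappa> \<alpha> \<noteq> {}"
  show "card (orbit (shift_Q \<eta> e) \<alpha>) \<le> n"
    if "n \<in> (\<lambda>L. card (orbit (shift_rpart d) L)) ` rpartitions_of e r \<kappa> \<alpha>" for n
    using that le by blast
  obtain L where L: "is_rpartition r L" "alpha_of e \<kappa> L = \<alpha>"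
    using \<alpha> by (auto simp: rpartitions_of_def)
  let ?m = "card (orbit (shift_Q \<eta> e) \<alpha>)"
  have "(shift_Q \<eta> e ^^ p) \<alpha> = \<alpha>"
    using shift_Q_period keys_alpha_of pos L(2) unfolding er by (metis nat_0_less_mult_iff)
  note m = funpow_card_orbit[OF pos(3) this]
  \<comment> \<open>The size of the orbit of the block is the least positive power of the shift that fixes it, so
      some member M of the block is fixed by the same power.\<close>
  obtain M where M: "M \<in> rpartitions_of e r \<kappa> \<alpha>" "(shift_rpart d ^^ ?m) M = M"
    using fixed[OF L(1), of ?m] m(2) L(2) unfolding rpartitions_of_def by blast
  have "card (orbit (shift_rpart d) M) \<le> ?m"
    unfolding orbit_of_period[OF m(1) M(2)] by (metis card_image_le card_lessThan finite_lessThan)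
  then have "card (orbit (shift_rpart d) M) = ?m" using le[OF M(1)] by simp
  then show "?m \<in> (\<lambda>L. card (orbit (shift_rpart d) L)) ` rpartitions_of e r \<kappa> \<alpha>"
    using M(1) by (metis imageI)
qed

end
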